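(* Let $(A_1,[\,]_1)=\mathcal{T}((A_1,+_1),a)$ and $(A_2,[\,]_2)=\mathcal{T}((A_2,+_2),b)$ be two knot-theoretic ternary groups. Then the following statements are equivalent: (1) $(A_1,[\,]_1)$ and $(A_2,[\,]_2)$ are isomorphic (as ternary groups); (2) there exists a group isomorphism $h\colon(A_1,+_1)\to(A_2,+_2)$ such that $b=h(a)$.
   Context: A ternary group $(A,[\,])$ is a non-empty set $A$ with an associative operation $[\,]\colon A^3\to A$ (that is, $[[abc]de]=[a[bcd]e]=[ab[cde]]$ for all $a,b,c,d,e$) such that for all $a,b,c\in A$ each of the equations $[zab]=c$, $[azb]=c$, $[abz]=c$ has a unique solution $z\in A$. A knot-theoretic ternary group is a ternary group such that, for all $a,b,c,d\in A$, $[[abc]cd]=[[ab[bcd]][bcd]d]$ and $[ab[bcd]]=[a[abc][[abc]cd]]$. For an abelian group $(A,+)$ and an element $a\in A$ of order one or two in $(A,+)$ (i.e. $a+a=0$), $\mathcal{T}((A,+),a)$ denotes the knot-theoretic ternary group $(A,[\,])$ with $[xyz]=x-y+z+a$. An isomorphism of ternary groups is a bijection $h\colon A_1\to A_2$ with $h([xyz]_1)=[h(x)h(y)h(z)]_2$ for all $x,y,z\in A_1$ (such a map automatically preserves skew elements, where the skew element $\bar x$ of $x$ is the unique solution $z$ of $[xzx]=x$). *)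

theory Defs
  imports "HOL-Algebra.Group"
begin

record 'a ternary_structure = "'a partial_object" +
  tern :: "'a \<Rightarrow> 'a \<Rightarrow> 'a \<Rightarrow> 'a"

locale ternary_group =
  fixes A :: "('a, 'm) ternary_structure_scheme" (structure)
  assumes nonempty: "carrier A \<noteq> {}"
    and tern_closed:
      "\<lbrakk>x \<in> carrier A; y \<in> carrier A; z \<in> carrier A\<rbrakk> \<Longrightarrow> tern A x y z \<in> carrier A"
    and tern_assoc_left:
      "\<lbrakk>a \<in> carrier A; b \<in> carrier A; c \<in> carrier A; d \<in> carrier A; e \<in> carrier A\<rbrakk>
        \<Longrightarrow> tern A (tern A a b c) d e = tern A a (tern A b c d) e"
    and tern_assoc_right:
      "\<lbrakk>a \<in> carrier A; b \<in> carrier A; c \<in> carrier A; d \<in> carrier A; e \<in> carrier A\<rbrakk>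
        \<Longrightarrow> tern A a (tern A b c d) e = tern A a b (tern A c d e)"
    and solvable_left:
      "\<lbrakk>a \<in> carrier A; b \<in> carrier A; c \<in> carrier A\<rbrakk> \<Longrightarrow> \<exists>!z. z \<in> carrier A \<and> tern A z a b = c"
    and solvable_middle:
      "\<lbrakk>a \<in> carrier A; b \<in> carrier A; c \<in> carrier A\<rbrakk> \<Longrightarrow> \<exists>!z. z \<in> carrier A \<and> tern A a z b = c"
    and solvable_right:
      "\<lbrakk>a \<in> carrier A; b \<in> carrier A; c \<in> carrier A\<rbrakk> \<Longrightarrow> \<exists>!z. z \<in> carrier A \<and> tern A a b z = c"

locale knot_theoretic_ternary_group = ternary_group +
  assumes knot_left:
      "\<lbrakk>a \<in> carrier A; b \<in> carrier A; c \<in> carrier A; d \<in> carrier A\<rbrakk>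
        \<Longrightarrow> tern A (tern A a b c) c d = tern A (tern A a b (tern A b c d)) (tern A b c d) d"
    and knot_right:
      "\<lbrakk>a \<in> carrier A; b \<in> carrier A; c \<in> carrier A; d \<in> carrier A\<rbrakk>
        \<Longrightarrow> tern A a b (tern A b c d) = tern A a (tern A a b c) (tern A (tern A a b c) c d)"

definition ternary_iso ::
  "('a, 'm) ternary_structure_scheme \<Rightarrow> ('b, 'n) ternary_structure_scheme \<Rightarrow> ('a \<Rightarrow> 'b) set"
  where "ternary_iso A B =
    {h. bij_betw h (carrier A) (carrier B) \<and>
        (\<forall>x\<in>carrier A. \<forall>y\<in>carrier A. \<forall>z\<in>carrier A.
          h (tern A x y z) = tern B (h x) (h y) (h z))}"

definition ternary_isomorphic ::
  "('a, 'm) ternary_structure_scheme \<Rightarrow> ('b, 'n) ternary_structure_scheme \<Rightarrow> bool"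
  where "ternary_isomorphic A B \<longleftrightarrow> ternary_iso A B \<noteq> {}"

text \<open>
  Abelian groups are in the multiplicative notation of HOL-Algebra, so the operation
  below is \<open>x - y + z + a\<close> and the condition \<open>a + a = 0\<close> is \<open>a \<otimes> a = \<one>\<close>.
\<close>

definition ternary_of :: "('a, 'm) monoid_scheme \<Rightarrow> 'a \<Rightarrow> 'a ternary_structure"
  where "ternary_of G a =
    \<lparr>carrier = carrier G, tern = (\<lambda>x y z. x \<otimes>\<^bsub>G\<^esub> inv\<^bsub>G\<^esub> y \<otimes>\<^bsub>G\<^esub> z \<otimes>\<^bsub>G\<^esub> a)\<rparr>"

lemma ternary_of_simps [simp]:
  "carrier (ternary_of G a) = carrier G"
  "tern (ternary_of G a) x y z = x \<otimes>\<^bsub>G\<^esub> inv\<^bsub>G\<^esub> y \<otimes>\<^bsub>G\<^esub> z \<otimes>\<^bsub>G\<^esub> a"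
  by (simp_all add: ternary_of_def)

lemma (in comm_group) ternary_of_knot_theoretic:
  assumes a: "a \<in> carrier G" and aa: "a \<otimes> a = \<one>"
  shows "knot_theoretic_ternary_group (ternary_of G a)"
proof -
  have ia: "inv a = a"
    using a aa by (simp add: inv_equality)
  have c1: "x \<otimes> (inv x \<otimes> y) = y" "inv x \<otimes> (x \<otimes> y) = y"
    if "x \<in> carrier G" "y \<in> carrier G" for x y
    using that by (simp_all add: m_assoc[symmetric])
  have c2: "x \<otimes> (u \<otimes> inv x) = u" "x \<otimes> (u \<otimes> (inv x \<otimes> z)) = u \<otimes> z"
    if "x \<in> carrier G" "u \<in> carrier G" "z \<in> carrier G" for x u z
    using that by (simp_all add: m_lcomm[of x u] c1)
  have c3: "x \<otimes> (u \<otimes> (v \<otimes> inv x)) = u \<otimes> v" "x \<otimes> (u \<otimes> (v \<otimes> (inv x \<otimes> z))) = u \<otimes> (v \<otimes> z)"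
    if "x \<in> carrier G" "u \<in> carrier G" "v \<in> carrier G" "z \<in> carrier G" for x u v z
    using that c2[of x "u \<otimes> v" z] by (simp_all add: m_assoc)
  have c4: "x \<otimes> (u \<otimes> (v \<otimes> (w \<otimes> inv x))) = u \<otimes> (v \<otimes> w)"
    "x \<otimes> (u \<otimes> (v \<otimes> (w \<otimes> (inv x \<otimes> z)))) = u \<otimes> (v \<otimes> (w \<otimes> z))"
    if "x \<in> carrier G" "u \<in> carrier G" "v \<in> carrier G" "w \<in> carrier G" "z \<in> carrier G"
    for x u v w z
    using that c3[of x "u \<otimes> v" w z] by (simp_all add: m_assoc)
  have aa': "a \<otimes> (a \<otimes> x) = x" if "x \<in> carrier G" for x
    using that a aa by (simp add: m_assoc[symmetric])
  note simps = a aa ia c1 c2 c3 c4 aa' m_ac inv_mult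
  show ?thesis
  proof (unfold_locales, simp_all only: ternary_of_simps)
    show "carrier G \<noteq> {}" by auto
  next
    fix p q r assume "p \<in> carrier G" "q \<in> carrier G" "r \<in> carrier G"
    then show "\<exists>!z. z \<in> carrier G \<and> z \<otimes> inv p \<otimes> q \<otimes> a = r"
      by (intro ex1I[of _ "p \<otimes> inv q \<otimes> r \<otimes> a"]) (auto simp: simps)
  next
    fix p q r assume "p \<in> carrier G" "q \<in> carrier G" "r \<in> carrier G"
    then show "\<exists>!z. z \<in> carrier G \<and> p \<otimes> inv z \<otimes> q \<otimes> a = r"
      by (intro ex1I[of _ "p \<otimes> q \<otimes> inv r \<otimes> a"]) (auto simp: simps)
  next
    fix p q r assume "p \<in> carrier G" "q \<in> carrier G" "r \<in> carrier G"
    then show "\<exists>!z. z \<in> carrier G \<and> p \<otimes> inv q \<otimes> z \<otimes> a = r"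
      by (intro ex1I[of _ "inv p \<otimes> q \<otimes> r \<otimes> a"]) (auto simp: simps)
  qed (simp_all add: simps)
qed

end

theory Submission imports Defs
begin

text \<open>
  A ternary isomorphism is a group isomorphism up to translation: dividing it by its value at
  the identity gives the group isomorphism. The parameter is transported because
  \<open>[\<one>, \<one>, \<one>] = a\<close>, and products are recovered from the ternary operation as
  \<open>x \<otimes> y = [x, a, y]\<close>, since \<open>a\<close> is its own inverse.
\<close>

lemma (in group) bij_betw_mult_right:
  assumes "c \<in> carrier G"
  shows "bij_betw (\<lambda>x. x \<otimes> c) (carrier G) (carrier G)"
  by (rule bij_betw_byWitness[where f' = "\<lambda>x. x \<otimes> inv c"])
    (use assms in \<open>auto simp: m_assoc\<close>)

text \<open>The ternary operation is a word in the group operations and the parameter, so a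
  homomorphism carries it to the same word with the parameter replaced by its image.\<close>

lemma group_iso_imp_ternary_iso:
  assumes "group G" "a \<in> carrier G" "group H" and h: "h \<in> iso G H"
  shows "h \<in> ternary_iso (ternary_of G a) (ternary_of H (h a))"
proof -
  interpret G: group G by fact
  interpret H: group H by fact
  interpret group_hom G H h
    using h by unfold_locales (simp add: iso_def)
  show ?thesis
    using h assms(2) by (simp add: ternary_iso_def iso_def)
qed

lemma ternary_iso_imp_group_iso:
  assumes "comm_group G" and a: "a \<in> carrier G" and aa: "a \<otimes>\<^bsub>G\<^esub> a = \<one>\<^bsub>G\<^esub>"
    and "comm_group H" and b: "b \<in> carrier H" and bb: "b \<otimes>\<^bsub>H\<^esub> b = \<one>\<^bsub>H\<^esub>"
    and f: "f \<in> ternary_iso (ternary_of G a) (ternary_of H b)"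
  shows "(\<lambda>x. f x \<otimes>\<^bsub>H\<^esub> inv\<^bsub>H\<^esub> f \<one>\<^bsub>G\<^esub>) \<in> iso G H"
    and "f a \<otimes>\<^bsub>H\<^esub> inv\<^bsub>H\<^esub> f \<one>\<^bsub>G\<^esub> = b"
proof -
  interpret G: comm_group G by fact
  interpret H: comm_group H by fact
  define t where "t = f \<one>\<^bsub>G\<^esub>"
  have tern: "f (x \<otimes>\<^bsub>G\<^esub> inv\<^bsub>G\<^esub> y \<otimes>\<^bsub>G\<^esub> z \<otimes>\<^bsub>G\<^esub> a) =
      f x \<otimes>\<^bsub>H\<^esub> inv\<^bsub>H\<^esub> f y \<otimes>\<^bsub>H\<^esub> f z \<otimes>\<^bsub>H\<^esub> b"
    if "x \<in> carrier G" "y \<in> carrier G" "z \<in> carrier G" for x y z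
    using f that by (auto simp: ternary_iso_def)
  have bij: "bij_betw f (carrier G) (carrier H)"
    using f by (simp add: ternary_iso_def)
  have closed: "f x \<in> carrier H" if "x \<in> carrier G" for x
    using bij that by (rule bij_betw_apply)
  have t: "t \<in> carrier H"
    by (simp add: t_def closed)
  have inv_a: "inv\<^bsub>G\<^esub> a = a"
    using a aa by (simp add: G.inv_equality)
  have inv_b: "inv\<^bsub>H\<^esub> b = b"
    using b bb by (simp add: H.inv_equality)
  \<comment> \<open>At three identities, \<open>tern\<close> has \<open>f a\<close> on the left,
    while on the right one \<open>t\<close> cancels against its inverse.\<close>
  have fa: "f a = t \<otimes>\<^bsub>H\<^esub> b"
    using tern[of "\<one>\<^bsub>G\<^esub>" "\<one>\<^bsub>G\<^esub>" "\<one>\<^bsub>G\<^esub>"] a b t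
    by (simp flip: t_def)
  \<comment> \<open>The extra inverse of \<open>t\<close> is what the translation absorbs:
    multiplying both sides by one more such inverse gives each factor \<open>f x\<close> and
    \<open>f y\<close> its own.\<close>
  have f_mult: "f (x \<otimes>\<^bsub>G\<^esub> y) = f x \<otimes>\<^bsub>H\<^esub> f y \<otimes>\<^bsub>H\<^esub> inv\<^bsub>H\<^esub> t"
    if x: "x \<in> carrier G" and y: "y \<in> carrier G" for x y
  proof -
    have "x \<otimes>\<^bsub>G\<^esub> inv\<^bsub>G\<^esub> a \<otimes>\<^bsub>G\<^esub> y \<otimes>\<^bsub>G\<^esub> a = x \<otimes>\<^bsub>G\<^esub> y \<otimes>\<^bsub>G\<^esub> (a \<otimes>\<^bsub>G\<^esub> a)"
      using x y a unfolding inv_a by (simp add: G.m_ac)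
    \<comment> \<open>The middle argument \<open>a\<close> has the image \<open>f a\<close> given by
      \<open>fa\<close>; as \<open>b\<close> is its own inverse, inverting this image leaves a
      factor \<open>b\<close>. It meets the \<open>b\<close> of the operation on \<open>H\<close>,
      and \<open>bb\<close> removes the pair.\<close>
    then have "f (x \<otimes>\<^bsub>G\<^esub> y) =
        f x \<otimes>\<^bsub>H\<^esub> (inv\<^bsub>H\<^esub> t \<otimes>\<^bsub>H\<^esub> b) \<otimes>\<^bsub>H\<^esub> f y \<otimes>\<^bsub>H\<^esub> b"
      using tern[OF x a y] x y t b by (simp add: aa fa H.inv_mult inv_b)
    also have "\<dots> = f x \<otimes>\<^bsub>H\<^esub> f y \<otimes>\<^bsub>H\<^esub> inv\<^bsub>H\<^esub> t \<otimes>\<^bsub>H\<^esub> (b \<otimes>\<^bsub>H\<^esub> b)"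
      using closed[OF x] closed[OF y] t b by (simp add: H.m_ac)
    finally show ?thesis
      using closed[OF x] closed[OF y] t by (simp add: bb)
  qed
  have "bij_betw (\<lambda>x. f x \<otimes>\<^bsub>H\<^esub> inv\<^bsub>H\<^esub> t) (carrier G) (carrier H)"
    using bij_betw_trans[OF bij H.bij_betw_mult_right[of "inv\<^bsub>H\<^esub> t"]] t
    by (simp add: comp_def)
  then show "(\<lambda>x. f x \<otimes>\<^bsub>H\<^esub> inv\<^bsub>H\<^esub> f \<one>\<^bsub>G\<^esub>) \<in> iso G H"
    using t by (fold t_def) (auto simp: iso_def hom_def f_mult closed H.m_ac)
  \<comment> \<open>By \<open>fa\<close>, commuting \<open>t\<close> past \<open>b\<close> brings it
    next to its inverse.\<close>
  show "f a \<otimes>\<^bsub>H\<^esub> inv\<^bsub>H\<^esub> f \<one>\<^bsub>G\<^esub> = b"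
    using t b by (fold t_def) (simp add: fa H.m_comm[of t b] H.m_assoc)
qed

theorem theorem4p16:
  fixes G :: "('a, 'm) monoid_scheme" and H :: "('b, 'n) monoid_scheme"
    and a :: 'a and b :: 'b
  assumes "comm_group G" and "a \<in> carrier G" and "a \<otimes>\<^bsub>G\<^esub> a = \<one>\<^bsub>G\<^esub>"
    and "comm_group H" and "b \<in> carrier H" and "b \<otimes>\<^bsub>H\<^esub> b = \<one>\<^bsub>H\<^esub>"
  shows "ternary_isomorphic (ternary_of G a) (ternary_of H b) \<longleftrightarrow> (\<exists>h\<in>iso G H. b = h a)"
proof
  assume "ternary_isomorphic (ternary_of G a) (ternary_of H b)"
  then obtain f where "f \<in> ternary_iso (ternary_of G a) (ternary_of H b)"
    by (auto simp: ternary_isomorphic_def)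
  \<comment> \<open>Both resulting facts concern the same translated map, which unification takes as
    the witness.\<close>
  from ternary_iso_imp_group_iso[OF assms this]
  show "\<exists>h\<in>iso G H. b = h a"
    by (intro bexI) simp_all
next
  assume "\<exists>h\<in>iso G H. b = h a"
  then show "ternary_isomorphic (ternary_of G a) (ternary_of H b)"
    using group_iso_imp_ternary_iso assms(1,2,4)
    by (fastforce simp: ternary_isomorphic_def comm_group_def)
qed

end
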